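(* Let $(\Omega,\mathcal{F},\mathbb{P})$ be a probability space with a normal filtration $(\mathcal{F}_t)_{t\in[0,\infty)}$ supporting a four-dimensional standard $(\mathcal{F}_t)_{t\in[0,\infty)}$-Brownian motion $W=(W_t)_{t\in[0,\infty)}$ with continuous sample paths. Let $T\in(0,\infty)$ and $x_0\in\mathbb{R}^4$ be arbitrary. Then there exist a globally bounded and infinitely often differentiable function $\mu\colon\mathbb{R}^4\to\mathbb{R}^4$ and a symmetric nonnegative matrix $B\in\mathbb{R}^{4\times4}$ such that the stochastic process $X\colon[0,T]\times\Omega\to\mathbb{R}^4$ with continuous sample paths satisfying $X(t)=x_0+\int_0^t\mu(X(s))\,ds+BW(t)$ for all $t\in[0,T]$ and its Euler--Maruyama approximations $Y^N\colon\{0,\frac{T}{N},\frac{2T}{N},\ldots,T\}\times\Omega\to\mathbb{R}^4$, $N\in\mathbb{N}$, satisfying $Y^N(0)=x_0$ and $$Y^N\big(\tfrac{(n+1)T}{N}\big)=Y^N\big(\tfrac{nT}{N}\big)+\mu\big(Y^N\big(\tfrac{nT}{N}\big)\big)\tfrac{T}{N}+B\big(W_{(n+1)T/N}-W_{nT/N}\big)$$ for all $n\in\{0,1,\ldots,N-1\}$, $N\in\mathbb{N}$, fulfill $$\lim_{N\to\infty}\Big(N^\alpha\cdot\mathbb{E}\big[\|X(T)-Y^N(T)\|\big]\Big)=\lim_{N\to\infty}\Big(N^\alpha\cdot\big\|\mathbb{E}[X(T)]-\mathbb{E}[Y^N(T)]\big\|\Big)=\begin{cases}0,&\alpha=0,\\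 \infty,&\alpha>0,\end{cases}$$ for all $\alpha\in[0,\infty)$. In particular, for every $\alpha\in(0,\infty)$ there exists no real number $c_\alpha\in(0,\infty)$ such that $\|\mathbb{E}[X(T)]-\mathbb{E}[Y^N(T)]\|\le c_\alpha\cdot N^{-\alpha}$ for all $N\in\mathbb{N}$.
   Context: $\|\cdot\|$ is the Euclidean norm. A normal filtration is one that is right-continuous and whose $\mathcal{F}_0$ contains all $\mathbb{P}$-null sets. *)

theory Defs
  imports "HOL-Probability.Probability"
begin

text \<open>
  Differentiability is in the Frechet sense. The derivative of a function on a
  finite-dimensional space is \<open>n\<close> times differentiable iff its evaluation at each fixed
  direction \<open>v\<close> is; recursing on these evaluations keeps the type of the function unchanged.
\<close>

primrec n_times_differentiable ::
  "nat \<Rightarrow> ('a::euclidean_space \<Rightarrow> 'b::real_normed_vector) \<Rightarrow> bool" where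
  "n_times_differentiable 0 f \<longleftrightarrow> True"
| "n_times_differentiable (Suc n) f \<longleftrightarrow>
     (\<forall>x. f differentiable at x) \<and>
     (\<forall>v. n_times_differentiable n (\<lambda>x. frechet_derivative f (at x) v))"

definition infinitely_often_differentiable ::
  "('a::euclidean_space \<Rightarrow> 'b::real_normed_vector) \<Rightarrow> bool" where
  "infinitely_often_differentiable f \<longleftrightarrow> (\<forall>n. n_times_differentiable n f)"

text \<open>Nonnegativity is meant in the sense of quadratic forms.\<close>

definition symmetric_nonnegative :: "real^'n^'n \<Rightarrow> bool" where
  "symmetric_nonnegative B \<longleftrightarrow> transpose B = B \<and> (\<forall>v. 0 \<le> v \<bullet> (B *v v))"

text \<open>
  The time set is \<open>[0,\<infinity>)\<close>, whereas \<^locale>\<open>filtration\<close> is indexed by a whole type; composing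
  with \<open>max 0\<close> imposes nothing on the values of \<open>F\<close> at negative times.
\<close>

definition normal_filtration :: "'a measure \<Rightarrow> (real \<Rightarrow> 'a measure) \<Rightarrow> bool" where
  "normal_filtration M F \<longleftrightarrow>
     filtration (space M) (\<lambda>t. F (max 0 t)) \<and>
     (\<forall>t\<ge>0. sets (F t) \<subseteq> sets M) \<and>
     (\<forall>t\<ge>0. sets (F t) = (\<Inter>s\<in>{t<..}. sets (F s))) \<and>
     null_sets M \<subseteq> sets (F 0)"

text \<open>
  Continuity of the sample paths is not part of this definition. The last two conjuncts say that
  \<open>W t - W s\<close> is normally distributed with mean \<open>0\<close> and covariance matrix \<open>t - s\<close> times the
  identity; note that \<^const>\<open>normal_density\<close> takes the standard deviation.
\<close>

definition standard_brownian_motion ::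
  "'a measure \<Rightarrow> (real \<Rightarrow> 'a measure) \<Rightarrow> (real \<Rightarrow> 'a \<Rightarrow> real^'n) \<Rightarrow> bool" where
  "standard_brownian_motion M F W \<longleftrightarrow>
     (\<forall>t\<ge>0. W t \<in> borel_measurable (F t)) \<and>
     (AE \<omega> in M. W 0 \<omega> = 0) \<and>
     (\<forall>s t. 0 \<le> s \<and> s < t \<longrightarrow>
        prob_space.indep_set M (sets (F s))
          (sets (vimage_algebra (space M) (\<lambda>\<omega>. W t \<omega> - W s \<omega>) borel)) \<and>
        prob_space.indep_vars M (\<lambda>_. borel) (\<lambda>i \<omega>. (W t \<omega> - W s \<omega>) $ i) UNIV \<and>
        (\<forall>i. distributed M lborel (\<lambda>\<omega>. (W t \<omega> - W s \<omega>) $ i)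
               (normal_density 0 (sqrt (t - s)))))"

text \<open>
  The noise is additive, so the equation is an integral equation for each single sample path and
  is required for every \<open>\<omega>\<close>. Only the values of \<open>X\<close> on \<open>[0,T]\<close> matter.
\<close>

definition sde_solution ::
  "'a measure \<Rightarrow> (real \<Rightarrow> 'a \<Rightarrow> real^'n) \<Rightarrow> real \<Rightarrow> real^'n \<Rightarrow> (real^'n \<Rightarrow> real^'n) \<Rightarrow> real^'n^'n
     \<Rightarrow> (real \<Rightarrow> 'a \<Rightarrow> real^'n) \<Rightarrow> bool" where
  "sde_solution M W T x0 \<mu> B X \<longleftrightarrow>
     (\<forall>t\<in>{0..T}. X t \<in> borel_measurable M) \<and>
     (\<forall>\<omega>\<in>space M. continuous_on {0..T} (\<lambda>t. X t \<omega>)) \<and>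
     (\<forall>\<omega>\<in>space M. \<forall>t\<in>{0..T}.
        X t \<omega> = x0 + integral {0..t} (\<lambda>s. \<mu> (X s \<omega>)) + B *v W t \<omega>)"

text \<open>
  \<open>Y\<close> is indexed by time; only its values at the grid points \<open>n T / N\<close> for \<open>n \<le> N\<close> matter, and these
  are uniquely determined by the recursion.
\<close>

definition euler_maruyama ::
  "'a measure \<Rightarrow> (real \<Rightarrow> 'a \<Rightarrow> real^'n) \<Rightarrow> real \<Rightarrow> real^'n \<Rightarrow> (real^'n \<Rightarrow> real^'n) \<Rightarrow> real^'n^'n
     \<Rightarrow> nat \<Rightarrow> (real \<Rightarrow> 'a \<Rightarrow> real^'n) \<Rightarrow> bool" where
  "euler_maruyama M W T x0 \<mu> B N Y \<longleftrightarrow>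
     (\<forall>\<omega>\<in>space M.
        Y 0 \<omega> = x0 \<and>
        (\<forall>n<N. Y (real (n + 1) * T / real N) \<omega> =
           Y (real n * T / real N) \<omega>
           + (T / real N) *\<^sub>R \<mu> (Y (real n * T / real N) \<omega>)
           + B *v (W (real (n + 1) * T / real N) \<omega> - W (real n * T / real N) \<omega>)))"

end

theory Submission
  imports Defs "HOL-Real_Asymp.Real_Asymp"
begin

text \<open>
  In coordinates \<open>z = x - x0\<close> only \<open>z2\<close> is driven by noise, \<open>z4\<close> is time, and \<open>z3\<close> integrates
  \<open>- sin (z4 / T)\<close>, so that \<open>z3\<close> equals \<open>clock T z4\<close> along the exact solution. The Euler scheme
  violates this relation by a deterministic amount \<open>\<delta>\<close> of exact order \<open>1 / N\<close>. The drift of \<open>z1\<close> is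
  \<open>u\<^sup>2 / (1 + u\<^sup>2)\<close> with \<open>u = (z3 - clock T z4) * exp (z2^3)\<close>: it vanishes along the exact solution,
  whereas for the Euler scheme it is at least \<open>1 / 2\<close> as soon as \<open>z2^3\<close> exceeds \<open>ln (1 / \<delta>)\<close>. As
  \<open>z2\<close> is Gaussian, this happens with probability about \<open>exp (- (ln N) powr (2/3) / T)\<close> or more, which
  decays slower than every power of \<open>N\<close>.
\<close>

section \<open>Calculus of \<open>n\<close> times differentiable functions\<close>

text \<open>Derivatives at a point are unique, so \<open>frechet_derivative\<close> in the recursion
  may be replaced by any explicitly known derivative. Each closure rule below then needs only the
  classical formula and induction on \<open>n\<close>.\<close>

lemma n_times_differentiable_Suc_iff:
  assumes "\<And>x. (f has_derivative f' x) (at x)"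
  shows "n_times_differentiable (Suc n) f \<longleftrightarrow> (\<forall>v. n_times_differentiable n (\<lambda>x. f' x v))"
proof -
  have "frechet_derivative f (at x) = f' x" for x
    using frechet_derivative_at[OF assms] by simp
  then show ?thesis
    using assms by (auto simp: differentiable_def)
qed

lemma n_times_differentiable_Suc_ex:
  assumes "n_times_differentiable (Suc n) f"
  shows "\<exists>f'. (\<forall>x. (f has_derivative f' x) (at x)) \<and> (\<forall>v. n_times_differentiable n (\<lambda>x. f' x v))"
  using assms by (intro exI[of _ "\<lambda>x. frechet_derivative f (at x)"]) (simp add: frechet_derivative_works)

lemma n_times_differentiable_Suc_D:
  "n_times_differentiable (Suc n) f \<Longrightarrow> n_times_differentiable n f"
  by (induction n arbitrary: f) auto

lemma n_times_differentiable_const: "n_times_differentiable n (\<lambda>x. c)"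
proof (induction n arbitrary: c)
  case (Suc n)
  then show ?case
    by (subst n_times_differentiable_Suc_iff[of _ "\<lambda>_ _. 0"]) auto
qed simp

lemma n_times_differentiable_bounded_linear:
  assumes "bounded_linear f"
  shows "n_times_differentiable n f"
proof (cases n)
  case (Suc m)
  have "(f has_derivative f) (at x)" for x
    using assms by (rule bounded_linear_imp_has_derivative)
  then show ?thesis
    unfolding Suc by (subst n_times_differentiable_Suc_iff) (auto intro: n_times_differentiable_const)
qed simp

lemma n_times_differentiable_add:
  "n_times_differentiable n f \<Longrightarrow> n_times_differentiable n g
    \<Longrightarrow> n_times_differentiable n (\<lambda>x. f x + g x)"
proof (induction n arbitrary: f g)
  case (Suc n)
  obtain f' where f': "\<And>x. (f has_derivative f' x) (at x)"
    "\<And>v. n_times_differentiable n (\<lambda>x. f' x v)"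
    using n_times_differentiable_Suc_ex[OF Suc.prems(1)] by blast
  obtain g' where g': "\<And>x. (g has_derivative g' x) (at x)"
    "\<And>v. n_times_differentiable n (\<lambda>x. g' x v)"
    using n_times_differentiable_Suc_ex[OF Suc.prems(2)] by blast
  have "((\<lambda>x. f x + g x) has_derivative (\<lambda>v. f' x v + g' x v)) (at x)" for x
    by (intro has_derivative_add f' g')
  then show ?case
    by (subst n_times_differentiable_Suc_iff) (auto intro: Suc.IH f' g')
qed simp

text \<open>Every summand of the product rule keeps one factor undifferentiated, and that factor is
  brought down from order \<open>Suc n\<close> to order \<open>n\<close>. Treating a general
  bilinear map covers real products and scalar multiples at once.\<close>

lemma n_times_differentiable_bilinear:
  assumes "bounded_bilinear B"
  shows "n_times_differentiable n f \<Longrightarrow> n_times_differentiable n g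
    \<Longrightarrow> n_times_differentiable n (\<lambda>x. B (f x) (g x))"
proof (induction n arbitrary: f g)
  case (Suc n)
  obtain f' where f': "\<And>x. (f has_derivative f' x) (at x)"
    "\<And>v. n_times_differentiable n (\<lambda>x. f' x v)"
    using n_times_differentiable_Suc_ex[OF Suc.prems(1)] by blast
  obtain g' where g': "\<And>x. (g has_derivative g' x) (at x)"
    "\<And>v. n_times_differentiable n (\<lambda>x. g' x v)"
    using n_times_differentiable_Suc_ex[OF Suc.prems(2)] by blast
  have "((\<lambda>x. B (f x) (g x)) has_derivative (\<lambda>v. B (f x) (g' x v) + B (f' x v) (g x))) (at x)" for x
    by (intro bounded_bilinear.FDERIV[OF assms] f' g')
  then show ?case
    by (subst n_times_differentiable_Suc_iff)
      (auto intro!: n_times_differentiable_add Suc.IH f' g' Suc.prems[THEN n_times_differentiable_Suc_D])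
qed simp

lemmas n_times_differentiable_mult = n_times_differentiable_bilinear[OF bounded_bilinear_mult]
lemmas n_times_differentiable_scaleR = n_times_differentiable_bilinear[OF bounded_bilinear_scaleR]

lemma n_times_differentiable_uminus:
  assumes "n_times_differentiable n f"
  shows "n_times_differentiable n (\<lambda>x. - f x)"
  using n_times_differentiable_scaleR[OF n_times_differentiable_const[of n "-1"] assms] by simp

lemma n_times_differentiable_diff:
  assumes "n_times_differentiable n f" and "n_times_differentiable n g"
  shows "n_times_differentiable n (\<lambda>x. f x - g x)"
  using n_times_differentiable_add[OF assms(1) n_times_differentiable_uminus[OF assms(2)]] by simp

lemma n_times_differentiable_power:
  fixes f :: "_ \<Rightarrow> real"
  assumes "n_times_differentiable n f"
  shows "n_times_differentiable n (\<lambda>x. f x ^ k)"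
  by (induction k) (auto intro: n_times_differentiable_const n_times_differentiable_mult assms)

text \<open>The outer function may change under differentiation, so a whole family closed under
  derivatives is treated at once.\<close>

lemma n_times_differentiable_compose_family:
  fixes g :: "'i \<Rightarrow> real \<Rightarrow> real"
  assumes "\<And>i. \<exists>j c. \<forall>y. (g i has_real_derivative c * g j y) (at y)"
  shows "n_times_differentiable n f \<Longrightarrow> n_times_differentiable n (\<lambda>x. g i (f x))"
proof (induction n arbitrary: i)
  case (Suc n)
  obtain f' where f': "\<And>x. (f has_derivative f' x) (at x)"
    "\<And>v. n_times_differentiable n (\<lambda>x. f' x v)"
    using n_times_differentiable_Suc_ex[OF Suc.prems(1)] by blast
  obtain j c where g: "\<And>y. (g i has_real_derivative c * g j y) (at y)"
    using assms by blast
  have "((\<lambda>x. g i (f x)) has_derivative (\<lambda>v. c * g j (f x) * f' x v)) (at x)" for x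
    using has_derivative_compose[OF f'(1) g[unfolded has_field_derivative_def]] by (simp add: mult.commute)
  then show ?case
    by (subst n_times_differentiable_Suc_iff)
      (auto intro!: n_times_differentiable_mult n_times_differentiable_const Suc.IH f'
        Suc.prems[THEN n_times_differentiable_Suc_D])
qed simp

lemma n_times_differentiable_exp:
  fixes f :: "_ \<Rightarrow> real"
  assumes "n_times_differentiable n f"
  shows "n_times_differentiable n (\<lambda>x. exp (f x))"
  by (rule n_times_differentiable_compose_family[of "\<lambda>_::unit. exp", OF _ assms])
    (auto intro!: exI[of _ 1] derivative_eq_intros)

lemma n_times_differentiable_sin_cos:
  fixes f :: "_ \<Rightarrow> real"
  assumes "n_times_differentiable n f"
  shows "n_times_differentiable n (\<lambda>x. sin (f x))"
    and "n_times_differentiable n (\<lambda>x. cos (f x))"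
proof -
  \<comment> \<open>A boolean index makes sine and cosine a family that is closed under
    differentiation up to sign.\<close>
  have *: "\<exists>j c. \<forall>y. ((if i then sin else cos) has_real_derivative c * (if j then sin else cos) y) (at y)"
    for i :: bool
  proof (cases i)
    case True
    then show ?thesis
      by (intro exI[of _ False] exI[of _ 1]) (auto intro!: derivative_eq_intros)
  next
    case False
    then show ?thesis
      by (intro exI[of _ True] exI[of _ "-1"]) (auto intro!: derivative_eq_intros)
  qed
  show "n_times_differentiable n (\<lambda>x. sin (f x))"
    using n_times_differentiable_compose_family[OF *, of n f True] assms by simp
  show "n_times_differentiable n (\<lambda>x. cos (f x))"
    using n_times_differentiable_compose_family[OF *, of n f False] assms by simp
qed

text \<open>The derivative is a product of \<open>f'\<close> and two copies of the reciprocal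
  itself, so the induction closes without enlarging the family of functions.\<close>

lemma n_times_differentiable_inverse:
  fixes f :: "_ \<Rightarrow> real"
  shows "n_times_differentiable n f \<Longrightarrow> (\<And>x. f x \<noteq> 0)
    \<Longrightarrow> n_times_differentiable n (\<lambda>x. inverse (f x))"
proof (induction n)
  case (Suc n)
  obtain f' where f': "\<And>x. (f has_derivative f' x) (at x)"
    "\<And>v. n_times_differentiable n (\<lambda>x. f' x v)"
    using n_times_differentiable_Suc_ex[OF Suc.prems(1)] by blast
  have "((\<lambda>x. inverse (f x)) has_derivative (\<lambda>v. - (inverse (f x) * f' x v * inverse (f x)))) (at x)" for x
    by (intro Deriv.has_derivative_inverse f' Suc.prems)
  then show ?case
    by (subst n_times_differentiable_Suc_iff)
      (auto intro!: n_times_differentiable_mult n_times_differentiable_uminus Suc.IH f'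
        Suc.prems(1)[THEN n_times_differentiable_Suc_D] Suc.prems(2))
qed simp

section \<open>The equation and its Euler scheme\<close>

text \<open>Its values stay in [0,1), which keeps the drift bounded although the argument contains
  an unbounded exponential, and 0 is its only zero.\<close>

definition saturation :: "real \<Rightarrow> real" where
  "saturation u = u\<^sup>2 / (1 + u\<^sup>2)"

text \<open>The antiderivative of \<open>- sin (s / T)\<close> that vanishes at 0. Scaling by
  \<open>T\<close> keeps the angle in [0,1] for times in [0,T], where cosine is at least
  \<open>cos 1 > 0\<close>.\<close>

definition clock :: "real \<Rightarrow> real \<Rightarrow> real" where
  "clock T s = T * (cos (s / T) - 1)"

definition drift :: "real \<Rightarrow> real^4 \<Rightarrow> real^4 \<Rightarrow> real^4" where
  "drift T x0 x =
     saturation ((x $ 3 - x0 $ 3 - clock T (x $ 4 - x0 $ 4)) * exp ((x $ 2 - x0 $ 2) ^ 3)) *\<^sub>R axis 1 1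
     - sin ((x $ 4 - x0 $ 4) / T) *\<^sub>R axis 3 1 + axis 4 1"

definition noise_matrix :: "real^4^4" where
  "noise_matrix = (\<chi> i j. if i = 2 \<and> j = 2 then 1 else 0)"

section \<open>Properties of the coefficients\<close>

lemma saturation_0: "saturation 0 = 0"
  by (simp add: saturation_def)

text \<open>The bound by 1 supplies integrability and domination; the quadratic bound makes the
  Euler error of a fixed path vanish in the limit.\<close>

lemma saturation_bounds: "0 \<le> saturation u" "saturation u \<le> 1" "saturation u \<le> u\<^sup>2"
proof -
  show "0 \<le> saturation u" "saturation u \<le> 1"
    by (auto simp: saturation_def divide_simps add_pos_nonneg)
  show "saturation u \<le> u\<^sup>2"
    unfolding saturation_def by (rule divide_left_mono[of 1, simplified]) (auto simp: add_pos_nonneg)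
qed

lemma saturation_ge_half: "1 \<le> u \<Longrightarrow> 1 / 2 \<le> saturation u"
  using one_le_power[of u 2] by (simp add: saturation_def divide_simps add_pos_nonneg)

lemma saturation_measurable [measurable]: "saturation \<in> borel_measurable borel"
  unfolding saturation_def[abs_def] by measurable

lemma drift_nth:
  "drift T x0 x $ 1 =
    saturation ((x $ 3 - x0 $ 3 - clock T (x $ 4 - x0 $ 4)) * exp ((x $ 2 - x0 $ 2) ^ 3))"
  "drift T x0 x $ 2 = 0"
  "drift T x0 x $ 3 = - sin ((x $ 4 - x0 $ 4) / T)"
  "drift T x0 x $ 4 = 1"
  by (simp_all add: drift_def axis_def)

lemma noise_matrix_mult: "noise_matrix *v w = w $ 2 *\<^sub>R axis 2 1"
  by (simp add: vec_eq_iff forall_4 noise_matrix_def matrix_vector_mult_def axis_def sum_4)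

lemma symmetric_nonnegative_noise_matrix: "symmetric_nonnegative noise_matrix"
  unfolding symmetric_nonnegative_def noise_matrix_mult
  by (auto simp: noise_matrix_def transpose_def vec_eq_iff inner_axis)

lemma bounded_drift: "bounded (range (drift T x0))"
proof -
  \<comment> \<open>Three components are not identically zero, and each is at most 1 in absolute
    value.\<close>
  have "norm (drift T x0 x) \<le> 3" for x
  proof -
    have "norm (drift T x0 x) \<le> (\<Sum>i\<in>UNIV. \<bar>drift T x0 x $ i\<bar>)"
      by (rule norm_le_l1_cart)
    also have "\<dots> \<le> 3"
      using saturation_bounds(1,2)[of "(x $ 3 - x0 $ 3 - clock T (x $ 4 - x0 $ 4)) * exp ((x $ 2 - x0 $ 2) ^ 3)"]
        abs_sin_le_one[of "(x $ 4 - x0 $ 4) / T"]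
      by (simp add: sum_4 drift_nth del: abs_sin_le_one)
    finally show ?thesis .
  qed
  then show ?thesis
    by (auto simp: bounded_iff)
qed

lemma smooth_drift: "infinitely_often_differentiable (drift T x0)"
proof -
  have "n_times_differentiable n (drift T x0)" for n
    \<comment> \<open>Quotients become products with \<open>inverse\<close>; the closing
      simplification checks that \<open>1 + u^2\<close> never vanishes.\<close>
    unfolding drift_def[abs_def] saturation_def clock_def divide_inverse
    by (intro n_times_differentiable_const n_times_differentiable_add n_times_differentiable_diff n_times_differentiable_scaleR
      n_times_differentiable_mult n_times_differentiable_exp n_times_differentiable_power
      n_times_differentiable_sin_cos n_times_differentiable_inverse
      n_times_differentiable_bounded_linear bounded_linear_vec_nth)
     (simp_all add: add_nonneg_eq_0_iff)
  then show ?thesis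
    by (simp add: infinitely_often_differentiable_def)
qed

lemma continuous_on_drift: "continuous_on S (drift T x0)"
proof -
  have "n_times_differentiable 1 (drift T x0)"
    using smooth_drift by (auto simp: infinitely_often_differentiable_def)
  then have "\<forall>x. drift T x0 differentiable at x"
    by simp
  then show ?thesis
    by (meson continuous_at_imp_continuous_on differentiable_imp_continuous_within)
qed

section \<open>Exact solution and Euler scheme in closed form\<close>

lemma has_integral_sin_clock:
  assumes "0 < T" "0 \<le> t"
  shows "((\<lambda>s. - sin (s / T)) has_integral clock T t) {0..t}"
proof -
  have "((\<lambda>s. - sin (s / T)) has_integral clock T t - clock T 0) {0..t}"
    using assms
    by (intro fundamental_theorem_of_calculus)
      (auto simp: clock_def has_real_derivative_iff_has_vector_derivative[symmetric]
        intro!: derivative_eq_intros)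
  then show ?thesis
    by (simp add: clock_def)
qed

text \<open>The value at time 0 is \<open>x0\<close> plus the second component of
  \<open>w 0\<close>: the Brownian motion starts at 0 only almost surely, while the equation is
  required for every sample path.\<close>

definition exact_path :: "real \<Rightarrow> real^4 \<Rightarrow> (real \<Rightarrow> real^4) \<Rightarrow> real \<Rightarrow> real^4" where
  "exact_path T x0 w t = x0 + w t $ 2 *\<^sub>R axis 2 1 + clock T t *\<^sub>R axis 3 1 + t *\<^sub>R axis 4 1"

lemma exact_path_nth:
  "exact_path T x0 w t $ 1 = x0 $ 1"
  "exact_path T x0 w t $ 2 = x0 $ 2 + w t $ 2"
  "exact_path T x0 w t $ 3 = x0 $ 3 + clock T t"
  "exact_path T x0 w t $ 4 = x0 $ 4 + t"
  by (simp_all add: exact_path_def axis_def)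

lemma exact_path_solves:
  assumes "0 < T" "0 \<le> t"
  shows "exact_path T x0 w t =
    x0 + integral {0..t} (\<lambda>s. drift T x0 (exact_path T x0 w s)) + noise_matrix *v w t"
proof -
  \<comment> \<open>Components 3 and 4 satisfy the clock relation, so the argument of
    \<open>saturation\<close> is 0 and the drift depends on time alone.\<close>
  have drift: "drift T x0 (exact_path T x0 w s) = - sin (s / T) *\<^sub>R axis 3 1 + axis 4 1" for s
    by (simp add: drift_def exact_path_nth saturation_0)
  have "((\<lambda>s. - sin (s / T) *\<^sub>R axis 3 1 + axis 4 1 :: real^4)
      has_integral clock T t *\<^sub>R axis 3 1 + t *\<^sub>R axis 4 1) {0..t}"
    using assms has_integral_const_real[of "axis 4 1 :: real^4" 0 t]
    by (intro has_integral_add has_integral_scaleR_left has_integral_sin_clock) auto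
  then have "integral {0..t} (\<lambda>s. drift T x0 (exact_path T x0 w s))
      = clock T t *\<^sub>R axis 3 1 + t *\<^sub>R axis 4 1"
    unfolding drift by (rule integral_unique)
  then show ?thesis
    by (simp add: exact_path_def noise_matrix_mult algebra_simps)
qed

text \<open>The equation is triangular: the components 4, 2, 3 and 1 are determined in this order.\<close>

lemma exact_path_unique:
  assumes T: "0 < T" and cont: "continuous_on {0..T} x"
    and eq: "\<And>t. t \<in> {0..T} \<Longrightarrow>
      x t = x0 + integral {0..t} (\<lambda>s. drift T x0 (x s)) + noise_matrix *v w t"
    and t: "t \<in> {0..T}"
  shows "x t = exact_path T x0 w t"
proof -
  \<comment> \<open>Continuity makes the drift integrable along the path, so the coordinate
    projection may be moved inside the integral.\<close>
  have nth: "x t $ i = x0 $ i + integral {0..t} (\<lambda>s. drift T x0 (x s) $ i) + (noise_matrix *v w t) $ i"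
    if t: "t \<in> {0..T}" for t i
  proof -
    have "continuous_on {0..t} (\<lambda>s. drift T x0 (x s))"
      using t by (intro continuous_on_compose2[OF continuous_on_drift[of UNIV]]
          continuous_on_subset[OF cont]) auto
    then have "(\<lambda>s. drift T x0 (x s)) integrable_on {0..t}"
      by (rule integrable_continuous_interval)
    then show ?thesis
      using eq[OF t] integral_linear[OF _ bounded_linear_vec_nth, of "\<lambda>s. drift T x0 (x s)" "{0..t}" i]
      by (simp add: o_def)
  qed
  have x4: "x t $ 4 = x0 $ 4 + t" if "t \<in> {0..T}" for t
    using nth[OF that, of 4] that by (simp add: drift_nth noise_matrix_mult axis_def)
  have x2: "x t $ 2 = x0 $ 2 + w t $ 2" if "t \<in> {0..T}" for t
    using nth[OF that, of 2] by (simp add: drift_nth noise_matrix_mult axis_def)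
  have x3: "x t $ 3 = x0 $ 3 + clock T t" if t: "t \<in> {0..T}" for t
  proof -
    have "integral {0..t} (\<lambda>s. drift T x0 (x s) $ 3) = integral {0..t} (\<lambda>s. - sin (s / T))"
      using t by (intro integral_cong) (auto simp: drift_nth x4)
    then show ?thesis
      using nth[OF t, of 3] integral_unique[OF has_integral_sin_clock[OF T, of t]] t
      by (simp add: noise_matrix_mult axis_def)
  qed
  have x1: "x t $ 1 = x0 $ 1" if t: "t \<in> {0..T}" for t
  proof -
    have "integral {0..t} (\<lambda>s. drift T x0 (x s) $ 1) = integral {0..t} (\<lambda>s. 0)"
      using t by (intro integral_cong) (auto simp: drift_nth x3 x4 saturation_0)
    then show ?thesis
      using nth[OF t, of 1] by (simp add: noise_matrix_mult axis_def)
  qed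
  show ?thesis
    using x1 x2 x3 x4 t by (simp add: vec_eq_iff forall_4 exact_path_nth)
qed

lemma sde_solution_eq:
  assumes "sde_solution M W T x0 (drift T x0) noise_matrix X" "0 < T" "t \<in> {0..T}" "\<omega> \<in> space M"
  shows "X t \<omega> = exact_path T x0 (\<lambda>s. W s \<omega>) t"
  using assms by (intro exact_path_unique) (auto simp: sde_solution_def)

text \<open>The error of the left-endpoint Riemann sum for \<^const>\<open>clock\<close> at grid point \<open>n\<close>.\<close>

definition clock_defect :: "real \<Rightarrow> nat \<Rightarrow> nat \<Rightarrow> real" where
  "clock_defect T N n = T * (1 - cos (n / N)) - T / N * (\<Sum>k<n. sin (real k / real N))"

text \<open>The displacement of the first Euler component after \<open>n\<close> steps, where
  \<open>d k\<close> is the displacement of the second component at grid point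
  \<open>k\<close>.\<close>

definition euler_sum :: "real \<Rightarrow> nat \<Rightarrow> (nat \<Rightarrow> real) \<Rightarrow> nat \<Rightarrow> real" where
  "euler_sum T N d n = T / N * (\<Sum>k<n. saturation (clock_defect T N k * exp (d k ^ 3)))"

text \<open>Induction over the grid. The scheme starts exactly at \<open>x0\<close> and adds up
  increments, so the noise enters as \<open>w t - w 0\<close>, unlike in
  \<open>exact_path\<close>.\<close>

lemma euler_path:
  assumes N: "0 < N" and T: "0 < T" and y0: "y 0 = x0"
    and step: "\<And>n. n < N \<Longrightarrow> y (real (n + 1) * T / real N) =
      y (real n * T / real N) + (T / real N) *\<^sub>R drift T x0 (y (real n * T / real N))
      + noise_matrix *v (w (real (n + 1) * T / real N) - w (real n * T / real N))"
  shows "n \<le> N \<Longrightarrow> y (real n * T / real N) =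
      x0 + euler_sum T N (\<lambda>k. (w (real k * T / real N) - w 0) $ 2) n *\<^sub>R axis 1 1
      + (w (real n * T / real N) - w 0) $ 2 *\<^sub>R axis 2 1
      + (clock_defect T N n + clock T (real n * T / real N)) *\<^sub>R axis 3 1
      + (real n * T / real N) *\<^sub>R axis 4 1"
proof (induction n)
  case 0
  then show ?case
    by (simp add: y0 euler_sum_def clock_defect_def clock_def)
next
  case (Suc n)
  \<comment> \<open>Defect and clock together form the left Riemann sum that the third Euler
    component accumulates.\<close>
  have clock: "clock_defect T N m + clock T (real m * T / real N) = - (T / N) * (\<Sum>k<m. sin (real k / real N))" for m
    using T by (simp add: clock_defect_def clock_def algebra_simps)
  let ?y = "y (real n * T / real N)" and ?d = "\<lambda>k. (w (real k * T / real N) - w 0) $ 2"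
  have IH: "?y $ 1 = x0 $ 1 + euler_sum T N ?d n" "?y $ 2 = x0 $ 2 + ?d n"
    "?y $ 3 = x0 $ 3 + (clock_defect T N n + clock T (real n * T / real N))"
    "?y $ 4 = x0 $ 4 + real n * T / real N"
    using Suc by (simp_all add: axis_def)
  have step_nth: "y (real (Suc n) * T / real N) $ i = ?y $ i + T / real N * drift T x0 ?y $ i
      + (if i = 2 then ?d (Suc n) - ?d n else 0)" for i
    using step[of n] Suc.prems by (simp add: noise_matrix_mult axis_def)
  \<comment> \<open>The clock value cancels in the argument of \<open>saturation\<close>, and only
    the defect survives.\<close>
  have "drift T x0 ?y $ 1 = saturation (clock_defect T N n * exp (?d n ^ 3))"
    unfolding drift_nth IH by simp
  then have 1: "y (real (Suc n) * T / real N) $ 1 = x0 $ 1 + euler_sum T N ?d (Suc n)"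
    unfolding step_nth IH by (simp add: euler_sum_def distrib_left)
  have 2: "y (real (Suc n) * T / real N) $ 2 = x0 $ 2 + ?d (Suc n)"
    unfolding step_nth IH drift_nth by simp
  have "drift T x0 ?y $ 3 = - sin (real n / real N)"
    unfolding drift_nth IH using T by simp
  then have 3: "y (real (Suc n) * T / real N) $ 3
      = x0 $ 3 + (clock_defect T N (Suc n) + clock T (real (Suc n) * T / real N))"
    unfolding step_nth IH clock by (simp add: distrib_left)
  have 4: "y (real (Suc n) * T / real N) $ 4 = x0 $ 4 + real (Suc n) * T / real N"
    unfolding step_nth IH drift_nth by (simp add: add_divide_distrib distrib_right)
  show ?case
    unfolding vec_eq_iff forall_4 using 1 2 3 4 by (simp add: axis_def)
qed

text \<open>The defect telescopes into one second-order Taylor remainder of cosine per grid step,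
  namely \<open>cos t / (2 * N^2)\<close> times \<open>T\<close> with \<open>t\<close> in [0,1].
  Cosine lies between \<open>cos 1\<close> and 1 there, so the remainders all have the same sign and
  cannot cancel.\<close>

lemma clock_defect_bounds:
  assumes N: "0 < N" and T: "0 < T" and "n \<le> N"
  shows "T * cos 1 * real n / (2 * (real N)\<^sup>2) \<le> clock_defect T N n"
    and "clock_defect T N n \<le> T * real n / (2 * (real N)\<^sup>2)"
proof -
  have step: "cos 1 / (2 * (real N)\<^sup>2) \<le> cos (k / N) - cos (Suc k / N) - sin (k / N) / N \<and>
      cos (k / N) - cos (Suc k / N) - sin (k / N) / N \<le> 1 / (2 * (real N)\<^sup>2)" if k: "k < N" for k
  proof -
    \<comment> \<open>The derivatives of cosine of orders 0, 1 and 2, in the form of a sequence; the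
      last branch is only evaluated at order 2.\<close>
    define diff where "diff = (\<lambda>m::nat. if m = 0 then cos else if m = 1 then (\<lambda>x::real. - sin x) else (\<lambda>x. - cos x))"
    have ex: "\<exists>t>k / N. t < Suc k / N \<and> cos (Suc k / N) =
       (\<Sum>m<2. (diff m (k / N) / fact m) * (Suc k / N - k / N)^m)
         + (diff 2 t / fact 2) * (Suc k / N - k / N)^2"
      using N by (intro Taylor_up[where a = "k / N"])
        (auto simp: diff_def less_2_cases_iff divide_strict_right_mono intro!: derivative_eq_intros)
    have h: "Suc k / N - k / N = 1 / N"
      by (simp add: diff_divide_distrib[symmetric])
    obtain t where t: "k / N < t" "t < Suc k / N" and
      "cos (Suc k / N) = (\<Sum>m<2. (diff m (k / N) / fact m) * (1 / N)^m) + (diff 2 t / fact 2) * (1 / N)^2"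
      using ex unfolding h by blast
    then have eq: "cos (Suc k / N) = cos (k / N) - sin (k / N) / N - cos t / (2 * (real N)\<^sup>2)"
      by (simp add: diff_def lessThan_Suc numeral_2_eq_2 power2_eq_square)
    have "0 \<le> k / N" "Suc k / N \<le> 1"
      using k by auto
    then have "0 \<le> t" "t \<le> 1"
      using t by linarith+
    then have "cos 1 \<le> cos t"
      using pi_gt3 by (intro cos_monotone_0_pi_le) auto
    then have "cos 1 / (2 * (real N)\<^sup>2) \<le> cos t / (2 * (real N)\<^sup>2)" "cos t / (2 * (real N)\<^sup>2) \<le> 1 / (2 * (real N)\<^sup>2)"
      by (intro divide_right_mono; simp)+
    then show ?thesis
      using eq by linarith
  qed
  \<comment> \<open>The cosine differences telescope to \<open>1 - cos (n / N)\<close>.\<close>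
  have "clock_defect T N n = (\<Sum>k<n. T * (cos (k / N) - cos (Suc k / N) - sin (k / N) / N))"
    by (induction n) (simp_all add: clock_defect_def algebra_simps)
  moreover have "(\<Sum>k<n. T * (cos 1 / (2 * (real N)\<^sup>2))) \<le> (\<Sum>k<n. T * (cos (k / N) - cos (Suc k / N) - sin (k / N) / N))"
    using step \<open>n \<le> N\<close> T by (intro sum_mono mult_left_mono) auto
  moreover have "(\<Sum>k<n. T * (cos (k / N) - cos (Suc k / N) - sin (k / N) / N)) \<le> (\<Sum>k<n. T * (1 / (2 * (real N)\<^sup>2)))"
    using step \<open>n \<le> N\<close> T by (intro sum_mono mult_left_mono) auto
  ultimately show "T * cos 1 * real n / (2 * (real N)\<^sup>2) \<le> clock_defect T N n"
    and "clock_defect T N n \<le> T * real n / (2 * (real N)\<^sup>2)"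
    by (simp_all add: mult_ac)
qed

section \<open>Size of the Euler error\<close>

text \<open>Only the unit interval from \<open>a\<close> to \<open>a + 1\<close> is kept. There the
  cube is at least \<open>a^3\<close>, so the saturation is at least 1/2. The density is bounded
  below uniformly in the variance: \<open>t \<le> T\<close> controls the prefactor and
  \<open>2 * t \<ge> T\<close> the exponent.\<close>

lemma normal_expectation_saturation_ge:
  assumes "prob_space M" and D: "distributed M lborel D (normal_density 0 (sqrt t))"
    and t: "T / 2 \<le> t" "t \<le> T" and T: "0 < T" and a: "0 \<le> a" "1 \<le> \<delta> * exp (a ^ 3)"
  shows "exp (- (a + 1)\<^sup>2 / T) / (2 * sqrt (2 * pi * T)) \<le> (LINT \<omega>|M. saturation (\<delta> * exp (D \<omega> ^ 3)))"
proof -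
  interpret prob_space M by fact
  have "0 < t"
    using t T by linarith
  have \<delta>: "0 < \<delta>"
    using a(2) by (metis exp_gt_zero not_le order_less_le_trans zero_less_mult_pos2 zero_less_one)
  have pointwise: "indicator {a..a+1} x *\<^sub>R (exp (- (a + 1)\<^sup>2 / T) / (2 * sqrt (2 * pi * T)))
      \<le> normal_density 0 (sqrt t) x * saturation (\<delta> * exp (x ^ 3))" for x
  proof (cases "x \<in> {a..a+1}")
    case True
    have "\<delta> * exp (a ^ 3) \<le> \<delta> * exp (x ^ 3)"
      using True a \<delta> by (auto intro!: power_mono)
    then have sat: "1 / 2 \<le> saturation (\<delta> * exp (x ^ 3))"
      using a by (intro saturation_ge_half) linarith
    have "x\<^sup>2 / (2 * t) \<le> (a + 1)\<^sup>2 / T"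
      using True a t T by (intro frac_le power_mono) auto
    then have "exp (- (a + 1)\<^sup>2 / T) \<le> exp (- x\<^sup>2 / (2 * t))"
      by simp
    moreover have "1 / sqrt (2 * pi * T) \<le> 1 / sqrt (2 * pi * t)"
      using \<open>0 < t\<close> t by (intro divide_left_mono) (auto intro!: mult_pos_pos)
    ultimately have "1 / sqrt (2 * pi * T) * exp (- (a + 1)\<^sup>2 / T)
        \<le> 1 / sqrt (2 * pi * t) * exp (- x\<^sup>2 / (2 * t))"
      using \<open>0 < t\<close> by (intro mult_mono) auto
    also have "\<dots> = normal_density 0 (sqrt t) x"
      using \<open>0 < t\<close> by (simp add: normal_density_def)
    finally have "1 / sqrt (2 * pi * T) * exp (- (a + 1)\<^sup>2 / T) \<le> normal_density 0 (sqrt t) x" .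
    then have "1 / sqrt (2 * pi * T) * exp (- (a + 1)\<^sup>2 / T) * (1 / 2)
        \<le> normal_density 0 (sqrt t) x * saturation (\<delta> * exp (x ^ 3))"
      using sat by (rule mult_mono) auto
    then show ?thesis
      using True by (simp add: mult_ac)
  qed (simp add: saturation_bounds)
  have int: "integrable lborel (\<lambda>x. normal_density 0 (sqrt t) x * saturation (\<delta> * exp (x ^ 3)))"
    using \<open>0 < t\<close> saturation_bounds
    by (intro Bochner_Integration.integrable_bound[OF integrable_normal_density[of "sqrt t" 0]])
      (auto simp: abs_mult intro!: mult_left_le)
  have "exp (- (a + 1)\<^sup>2 / T) / (2 * sqrt (2 * pi * T))
      = (LINT x|lborel. indicator {a..a+1} x *\<^sub>R (exp (- (a + 1)\<^sup>2 / T) / (2 * sqrt (2 * pi * T))))"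
    by simp
  also have "\<dots> \<le> (LINT x|lborel. normal_density 0 (sqrt t) x * saturation (\<delta> * exp (x ^ 3)))"
    by (intro integral_mono int pointwise) simp
  also have "\<dots> = (LINT \<omega>|M. saturation (\<delta> * exp (D \<omega> ^ 3)))"
    using D by (rule distributed_integral) auto
  finally show ?thesis .
qed

section \<open>Bounds and pathwise convergence of the Euler error\<close>

lemma euler_sum_bounds:
  assumes "0 < N" "0 < T"
  shows "0 \<le> euler_sum T N d N" "euler_sum T N d N \<le> T"
proof -
  have "(\<Sum>k<N. saturation (clock_defect T N k * exp (d k ^ 3))) \<le> (\<Sum>k<N. 1)"
    by (intro sum_mono saturation_bounds)
  then show "euler_sum T N d N \<le> T"
    using assms by (simp add: euler_sum_def divide_simps mult_left_le)
  show "0 \<le> euler_sum T N d N"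
    unfolding euler_sum_def using assms
    by (intro mult_nonneg_nonneg sum_nonneg saturation_bounds) auto
qed

lemma clock_defect_nonneg:
  assumes "0 < N" "0 < T" "n \<le> N"
  shows "0 \<le> clock_defect T N n"
proof -
  have "0 < cos (1::real)"
    using pi_gt3 by (intro cos_gt_zero) auto
  then have "0 \<le> T * cos 1 * real n / (2 * (real N)\<^sup>2)"
    using assms by simp
  then show ?thesis
    using clock_defect_bounds(1)[OF assms] by linarith
qed

lemma clock_defect_le:
  assumes "0 < N" "0 < T" "n \<le> N"
  shows "clock_defect T N n \<le> T / (2 * real N)"
proof -
  have "T * real n / (2 * (real N)\<^sup>2) \<le> T * real N / (2 * (real N)\<^sup>2)"
    using assms by (intro divide_right_mono mult_left_mono) auto
  also have "\<dots> = T / (2 * real N)"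
    by (simp add: power2_eq_square)
  finally show ?thesis
    using clock_defect_bounds(2)[OF assms] by linarith
qed

lemma clock_defect_tendsto:
  assumes "0 < T"
  shows "(\<lambda>N. clock_defect T N N) \<longlonglongrightarrow> 0"
proof (rule tendsto_sandwich[OF _ _ tendsto_const])
  show "\<forall>\<^sub>F N in sequentially. 0 \<le> clock_defect T N N"
    using eventually_gt_at_top[of 0] by eventually_elim (auto intro: clock_defect_nonneg assms)
  show "\<forall>\<^sub>F N in sequentially. clock_defect T N N \<le> T / (2 * real N)"
    using eventually_gt_at_top[of 0] by eventually_elim (auto intro: clock_defect_le assms)
  show "(\<lambda>N. T / (2 * real N)) \<longlonglongrightarrow> 0"
    by real_asymp
qed

text \<open>Cubing and \<open>exp\<close> are monotone, so for displacements bounded by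
  \<open>C\<close> all arguments of \<open>saturation\<close> are of order 1/N. The quadratic bound
  then makes the average of the \<open>N\<close> terms of order \<open>1 / N^2\<close>.\<close>

lemma euler_sum_tendsto:
  assumes T: "0 < T" and C: "\<And>N k. k < N \<Longrightarrow> d N k \<le> C"
  shows "(\<lambda>N. euler_sum T N (d N) N) \<longlonglongrightarrow> 0"
proof (rule tendsto_sandwich[OF _ _ tendsto_const])
  show "\<forall>\<^sub>F N in sequentially. 0 \<le> euler_sum T N (d N) N"
    using eventually_gt_at_top[of 0] by eventually_elim (auto intro: euler_sum_bounds T)
  show "\<forall>\<^sub>F N in sequentially. euler_sum T N (d N) N \<le> T * (T / (2 * real N) * exp (C ^ 3))\<^sup>2"
    using eventually_gt_at_top[of 0]
  proof eventually_elim
    case (elim N)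
    have "saturation (clock_defect T N k * exp (d N k ^ 3)) \<le> (T / (2 * real N) * exp (C ^ 3))\<^sup>2"
      if "k < N" for k
    proof -
      have "clock_defect T N k * exp (d N k ^ 3) \<le> T / (2 * real N) * exp (C ^ 3)"
        using that elim T C[OF that]
        by (intro mult_mono clock_defect_le) (auto intro: power_mono_odd)
      moreover have "0 \<le> clock_defect T N k * exp (d N k ^ 3)"
        using that elim T by (intro mult_nonneg_nonneg clock_defect_nonneg) auto
      ultimately have "(clock_defect T N k * exp (d N k ^ 3))\<^sup>2 \<le> (T / (2 * real N) * exp (C ^ 3))\<^sup>2"
        by (rule power_mono)
      then show ?thesis
        using saturation_bounds(3) order_trans by blast
    qed
    then have "(\<Sum>k<N. saturation (clock_defect T N k * exp (d N k ^ 3)))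
        \<le> (\<Sum>k<N. (T / (2 * real N) * exp (C ^ 3))\<^sup>2)"
      by (intro sum_mono) auto
    then have "euler_sum T N (d N) N \<le> T / N * (\<Sum>k<N. (T / (2 * real N) * exp (C ^ 3))\<^sup>2)"
      unfolding euler_sum_def using T by (intro mult_left_mono) auto
    then show ?case
      using elim by simp
  qed
  have "(\<lambda>N. T / (2 * real N)) \<longlonglongrightarrow> 0"
    by real_asymp
  then have "(\<lambda>N. T * (T / (2 * real N) * exp (C ^ 3))\<^sup>2) \<longlonglongrightarrow> T * (0 * exp (C ^ 3))\<^sup>2"
    by (intro tendsto_intros)
  then show "(\<lambda>N. T * (T / (2 * real N) * exp (C ^ 3))\<^sup>2) \<longlonglongrightarrow> 0"
    by simp
qed

text \<open>Only indices \<open>k\<close> with \<open>N \<le> 2 * k\<close> are kept: there the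
  variance lies between \<open>T / 2\<close> and \<open>T\<close>, and the defect is at least
  \<open>T * cos 1 / (4 * N)\<close>, so one bound serves all of them. The discarded terms are
  nonnegative.\<close>

lemma expectation_euler_sum_ge:
  assumes "prob_space M" and T: "0 < T" and N: "2 \<le> N"
    and D: "\<And>k. 0 < k \<Longrightarrow> k < N \<Longrightarrow>
      distributed M lborel (D k) (normal_density 0 (sqrt (real k * T / real N)))"
    and meas: "\<And>k. D k \<in> borel_measurable M"
    and a: "0 \<le> a" "1 \<le> T * cos 1 / (4 * real N) * exp (a ^ 3)"
  shows "T / 4 * (exp (- (a + 1)\<^sup>2 / T) / (2 * sqrt (2 * pi * T)))
    \<le> (LINT \<omega>|M. euler_sum T N (\<lambda>k. D k \<omega>) N)"
proof -
  interpret prob_space M by fact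
  define p where "p = exp (- (a + 1)\<^sup>2 / T) / (2 * sqrt (2 * pi * T))"
  have "0 \<le> p"
    using T by (simp add: p_def)
  define E where "E k = (LINT \<omega>|M. saturation (clock_defect T N k * exp (D k \<omega> ^ 3)))" for k
  have int: "integrable M (\<lambda>\<omega>. saturation (clock_defect T N k * exp (D k \<omega> ^ 3)))" for k
    using meas saturation_bounds by (intro integrable_const_bound[of _ 1]) auto
  have E_nonneg: "0 \<le> E k" for k
    unfolding E_def by (intro Bochner_Integration.integral_nonneg saturation_bounds)
  have E_ge: "p \<le> E k" if k: "N \<le> 2 * k" "k < N" for k
    unfolding E_def p_def
  proof (rule normal_expectation_saturation_ge[OF \<open>prob_space M\<close> D])
    show "0 < k" "k < N"
      using k N by auto
    show "T / 2 \<le> real k * T / real N" "real k * T / real N \<le> T"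
      using k N T by (auto simp: field_simps)
    have "0 < cos (1::real)"
      using pi_gt3 by (intro cos_gt_zero) auto
    then have "T * cos 1 / (4 * real N) \<le> T * cos 1 * real k / (2 * (real N)\<^sup>2)"
      using k N T by (simp add: field_simps power2_eq_square)
    also have "\<dots> \<le> clock_defect T N k"
      using k N T by (intro clock_defect_bounds) auto
    finally have "T * cos 1 / (4 * real N) * exp (a ^ 3) \<le> clock_defect T N k * exp (a ^ 3)"
      by (rule mult_right_mono) simp
    then show "1 \<le> clock_defect T N k * exp (a ^ 3)"
      using a(2) by linarith
  qed (use T a in auto)
  \<comment> \<open>The set has \<open>N div 2\<close> elements, which is at least
    \<open>N / 4\<close> once \<open>N \<ge> 2\<close>; with the weight \<open>T / N\<close> this
    gives the factor \<open>T / 4\<close>.\<close>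
  have "N \<le> 4 * card {N - N div 2..<N}"
    using N by simp
  then have "real N * p \<le> real (4 * card {N - N div 2..<N}) * p"
    using \<open>0 \<le> p\<close> by (intro mult_right_mono of_nat_mono)
  then have "real N * p / 4 \<le> (\<Sum>k\<in>{N - N div 2..<N}. p)"
    by simp
  also have "\<dots> \<le> (\<Sum>k\<in>{N - N div 2..<N}. E k)"
    by (intro sum_mono E_ge) auto
  also have "\<dots> \<le> (\<Sum>k<N. E k)"
    by (intro sum_mono2 E_nonneg) auto
  finally have "T / N * (real N * p / 4) \<le> T / N * (\<Sum>k<N. E k)"
    using T by (intro mult_left_mono) auto
  also have "\<dots> = (LINT \<omega>|M. euler_sum T N (\<lambda>k. D k \<omega>) N)"
    unfolding euler_sum_def E_def using int by simp
  finally show ?thesis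
    using N by (simp add: p_def)
qed

text \<open>The exponent grows like \<open>(ln N) powr (2/3)\<close>, which is of smaller order than
  \<open>ln N\<close>, so every positive power of \<open>N\<close> wins against the
  exponential.\<close>

lemma slow_rate_at_top:
  fixes \<alpha> c T :: real
  assumes "0 < \<alpha>" "0 < c" "0 < T"
  shows "filterlim (\<lambda>N. real N powr \<alpha> *
    (T / 4 * (exp (- (ln (c * real N) powr (1/3) + 1)\<^sup>2 / T) / (2 * sqrt (2 * pi * T))))) at_top sequentially"
proof -
  have "0 < pi" by simp
  with assms show ?thesis
    by real_asymp
qed

lemma distributed_normal_integrable:
  assumes "distributed M lborel D (normal_density 0 \<sigma>)" "0 < \<sigma>"
  shows "integrable M D"
  using distributed_integrable[OF assms(1), of "\<lambda>x. x"] integrable_normal_moment_nz_1[OF assms(2), of 0]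
  by simp

text \<open>Existence and uniqueness on [0,T] let the quantifier over \<open>X\<close> speak of one
  process. The integrability claims ensure that no expectation is merely the default value 0 of a
  non-integrable function, and \<open>ereal\<close> admits the limit \<infinity>.\<close>

theorem theorem1p3:
  fixes M :: "'a measure" and F :: "real \<Rightarrow> 'a measure" and W :: "real \<Rightarrow> 'a \<Rightarrow> real^4"
    and T :: real and x0 :: "real^4"
  assumes "prob_space M"
    and "normal_filtration M F"
    and "standard_brownian_motion M F W"
    and "\<And>\<omega>. \<omega> \<in> space M \<Longrightarrow> continuous_on {0..} (\<lambda>t. W t \<omega>)"
    and "0 < T"
  shows "\<exists>(\<mu> :: real^4 \<Rightarrow> real^4) (B :: real^4^4).
    bounded (range \<mu>) \<and> infinitely_often_differentiable \<mu> \<and> symmetric_nonnegative B \<and>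
    (\<exists>X. sde_solution M W T x0 \<mu> B X) \<and>
    (\<forall>X X'. sde_solution M W T x0 \<mu> B X \<and> sde_solution M W T x0 \<mu> B X' \<longrightarrow>
       (\<forall>t\<in>{0..T}. \<forall>\<omega>\<in>space M. X t \<omega> = X' t \<omega>)) \<and>
    (\<forall>X Y. sde_solution M W T x0 \<mu> B X \<and> (\<forall>N\<ge>1. euler_maruyama M W T x0 \<mu> B N (Y N)) \<longrightarrow>
       integrable M (X T) \<and> (\<forall>N\<ge>1. integrable M (Y N T)) \<and>
       (\<forall>\<alpha>\<ge>0.
          ((\<lambda>N. ereal (real N powr \<alpha> * (LINT \<omega>|M. norm (X T \<omega> - Y N T \<omega>))))
             \<longlonglongrightarrow> (if \<alpha> = 0 then 0 else \<infinity>)) \<and>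
          ((\<lambda>N. ereal (real N powr \<alpha> * norm ((LINT \<omega>|M. X T \<omega>) - (LINT \<omega>|M. Y N T \<omega>))))
             \<longlonglongrightarrow> (if \<alpha> = 0 then 0 else \<infinity>))) \<and>
       (\<forall>\<alpha>>0. \<not> (\<exists>c>0. \<forall>N\<ge>1.
          norm ((LINT \<omega>|M. X T \<omega>) - (LINT \<omega>|M. Y N T \<omega>)) \<le> c * real N powr (- \<alpha>))))"
proof -
  interpret prob_space M by fact
  note T = \<open>0 < T\<close>
  note cont = assms(4)

  \<comment> \<open>Measurability of the driving motion and law of its displacement\<close>
  have W_meas: "W t \<in> borel_measurable M" if "0 \<le> t" for t
  proof -
    have filt: "filtration (space M) (\<lambda>t. F (max 0 t))" and subset: "\<forall>t\<ge>0. sets (F t) \<subseteq> sets M"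
      using assms(2) unfolding normal_filtration_def by blast+
    have "space (F t) = space M"
      using filtration.space_F[OF filt, of t] that by simp
    moreover have "W t \<in> borel_measurable (F t)"
      using assms(3) that unfolding standard_brownian_motion_def by blast
    ultimately show ?thesis
      using subset that measurable_mono[of borel borel "F t" M] by blast
  qed
  have W0: "AE \<omega> in M. W 0 \<omega> = 0"
    using assms(3) unfolding standard_brownian_motion_def by blast
  define D where "D t \<omega> = (W t \<omega> - W 0 \<omega>) $ 2" for t \<omega>
  have D_meas: "D t \<in> borel_measurable M" if "0 \<le> t" for t
    unfolding D_def using W_meas[OF that] W_meas[of 0]
    by (intro borel_measurable_continuous_on[where f = "\<lambda>x. x $ 2"]) (auto intro: continuous_intros)
  have D: "distributed M lborel (D t) (normal_density 0 (sqrt t))" if "0 < t" for t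
  proof -
    have "distributed M lborel (\<lambda>\<omega>. (W t \<omega> - W 0 \<omega>) $ 2) (normal_density 0 (sqrt (t - 0)))"
      using assms(3) that unfolding standard_brownian_motion_def by blast
    then show ?thesis
      by (simp add: D_def[abs_def])
  qed

  \<comment> \<open>The error of the first component as a random variable\<close>
  define S where "S N \<omega> = euler_sum T N (\<lambda>k. D (real k * T / real N) \<omega>) N" for N \<omega>
  have S_meas: "S N \<in> borel_measurable M" for N
  proof -
    have [measurable]: "D (real k * T / real N) \<in> borel_measurable M" for k
      using T by (intro D_meas) auto
    show ?thesis
      unfolding S_def[abs_def] euler_sum_def by measurable
  qed
  have S_int: "integrable M (S N)" if "0 < N" for N
    using euler_sum_bounds[OF that T] S_meas
    by (intro integrable_const_bound[of _ T]) (auto simp: S_def)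
  have S_lim: "(\<lambda>N. S N \<omega>) \<longlonglongrightarrow> 0" if \<omega>: "\<omega> \<in> space M" for \<omega>
  proof -
    \<comment> \<open>A continuous path is bounded on [0,T]; the bound \<open>C\<close> may depend
      on the path because only pointwise convergence is claimed.\<close>
    have "continuous_on {0..T} (\<lambda>t. W t \<omega>)"
      by (rule continuous_on_subset[OF cont[OF \<omega>]]) auto
    then have "continuous_on {0..T} (\<lambda>t. D t \<omega>)"
      unfolding D_def by (intro continuous_intros)
    then have "bounded ((\<lambda>t. D t \<omega>) ` {0..T})"
      by (intro compact_imp_bounded compact_continuous_image compact_Icc)
    then obtain C where "\<forall>t\<in>{0..T}. \<bar>D t \<omega>\<bar> \<le> C"
      by (auto simp: bounded_iff)
    then have C: "D t \<omega> \<le> C" if "t \<in> {0..T}" for t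
      using that by (auto simp: abs_le_iff)
    show ?thesis
      unfolding S_def using T
      by (intro euler_sum_tendsto[where C = C] C) (auto simp: field_simps)
  qed

  \<comment> \<open>Existence of the solution\<close>
  let ?B = noise_matrix and ?\<mu> = "drift T x0"
  have ex: "sde_solution M W T x0 ?\<mu> ?B (\<lambda>t \<omega>. exact_path T x0 (\<lambda>s. W s \<omega>) t)"
    unfolding sde_solution_def
  proof (intro conjI ballI)
    fix t assume "t \<in> {0..T}"
    then have "(\<lambda>\<omega>. W t \<omega> $ 2) \<in> borel_measurable M"
      using W_meas by (intro borel_measurable_continuous_on[where f = "\<lambda>x. x $ 2"])
        (auto intro: continuous_intros)
    then show "(\<lambda>\<omega>. exact_path T x0 (\<lambda>s. W s \<omega>) t) \<in> borel_measurable M"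
      unfolding exact_path_def by measurable
  next
    fix \<omega> assume "\<omega> \<in> space M"
    then show "continuous_on {0..T} (\<lambda>t. exact_path T x0 (\<lambda>s. W s \<omega>) t)"
      unfolding exact_path_def clock_def using T
      by (intro continuous_intros continuous_on_subset[OF cont]) auto
  next
    fix \<omega> t assume "t \<in> {0..T}"
    then show "exact_path T x0 (\<lambda>s. W s \<omega>) t = x0
        + integral {0..t} (\<lambda>s. ?\<mu> (exact_path T x0 (\<lambda>s. W s \<omega>) s)) + ?B *v W t \<omega>"
      using T by (intro exact_path_solves) auto
  qed
  show ?thesis
  proof (intro exI[of _ ?\<mu>] exI[of _ ?B] conjI allI impI bounded_drift smooth_drift
      symmetric_nonnegative_noise_matrix)
    show "\<exists>X. sde_solution M W T x0 ?\<mu> ?B X"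
      using ex by blast
  next
    fix X X'
    assume "sde_solution M W T x0 ?\<mu> ?B X \<and> sde_solution M W T x0 ?\<mu> ?B X'"
    then show "\<forall>t\<in>{0..T}. \<forall>\<omega>\<in>space M. X t \<omega> = X' t \<omega>"
      using T by (metis sde_solution_eq)
  next
    fix X Y
    assume *: "sde_solution M W T x0 ?\<mu> ?B X \<and> (\<forall>N\<ge>1. euler_maruyama M W T x0 ?\<mu> ?B N (Y N))"

    \<comment> \<open>Closed forms and integrability at the final time\<close>
    have X: "X T \<omega> = x0 + W T \<omega> $ 2 *\<^sub>R axis 2 1 + clock T T *\<^sub>R axis 3 1 + T *\<^sub>R axis 4 1"
      if "\<omega> \<in> space M" for \<omega>
      using sde_solution_eq[of M W T x0 X T \<omega>] * that T by (simp add: exact_path_def)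
    have Y: "Y N T \<omega> = x0 + S N \<omega> *\<^sub>R axis 1 1 + D T \<omega> *\<^sub>R axis 2 1
        + (clock_defect T N N + clock T T) *\<^sub>R axis 3 1 + T *\<^sub>R axis 4 1"
      if "\<omega> \<in> space M" "0 < N" for N \<omega>
      using euler_path[of N T "\<lambda>t. Y N t \<omega>" x0 "\<lambda>t. W t \<omega>" N] * that T
      by (simp add: euler_maruyama_def S_def D_def)
    have DT_int: "integrable M (D T)"
      using distributed_normal_integrable[OF D[OF T]] T by simp
    \<comment> \<open>The law is known for the increment from time 0; it agrees with
      \<open>W T\<close> almost surely.\<close>
    have WT_int: "integrable M (\<lambda>\<omega>. W T \<omega> $ 2)"
    proof (rule integrable_cong_AE_imp[OF DT_int])
      show "(\<lambda>\<omega>. W T \<omega> $ 2) \<in> borel_measurable M"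
        using W_meas T by (intro borel_measurable_continuous_on[where f = "\<lambda>x. x $ 2"])
          (auto intro: continuous_intros)
      show "AE \<omega> in M. D T \<omega> = W T \<omega> $ 2"
        using W0 by eventually_elim (simp add: D_def)
    qed
    have X_int: "integrable M (X T)"
      by (subst Bochner_Integration.integrable_cong[OF refl X])
        (auto intro!: Bochner_Integration.integrable_add integrable_scaleR_left WT_int)
    have Y_int: "integrable M (Y N T)" if "0 < N" for N
      by (subst Bochner_Integration.integrable_cong[OF refl Y[OF _ that]])
        (auto intro!: Bochner_Integration.integrable_add integrable_scaleR_left DT_int S_int[OF that])

    \<comment> \<open>Strong error \<open>s\<close> and weak error \<open>e\<close>\<close>
    define s where "s N = (LINT \<omega>|M. norm (X T \<omega> - Y N T \<omega>))" for N
    define e where "e N = norm ((LINT \<omega>|M. X T \<omega>) - (LINT \<omega>|M. Y N T \<omega>))" for N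
    have e_eq: "e N = norm (LINT \<omega>|M. X T \<omega> - Y N T \<omega>)" if "0 < N" for N
      unfolding e_def using X_int Y_int[OF that] by simp
    have e_le_s: "e N \<le> s N" if "0 < N" for N
      unfolding e_eq[OF that] s_def by (rule integral_norm_bound)
    \<comment> \<open>The noise in the second component cancels up to \<open>W 0\<close>, which
      vanishes only almost surely.\<close>
    have diff: "AE \<omega> in M. X T \<omega> - Y N T \<omega> = - (S N \<omega> *\<^sub>R axis 1 1 + clock_defect T N N *\<^sub>R axis 3 1)"
      if "0 < N" for N
      using W0 AE_space by eventually_elim (simp add: X Y that D_def algebra_simps)
    \<comment> \<open>A norm dominates each component, and the first component of the mean error is
      minus the expectation of \<open>S N\<close>.\<close>
    have ES_le_e: "(LINT \<omega>|M. S N \<omega>) \<le> e N" if N: "0 < N" for N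
    proof -
      have "(LINT \<omega>|M. X T \<omega> - Y N T \<omega>) $ 1 = (LINT \<omega>|M. (X T \<omega> - Y N T \<omega>) $ 1)"
        using X_int Y_int[OF N]
        by (intro integral_bounded_linear[OF bounded_linear_vec_nth, symmetric]) auto
      also have "\<dots> = (LINT \<omega>|M. - S N \<omega>)"
      proof (rule integral_cong_AE)
        show "AE \<omega> in M. (X T \<omega> - Y N T \<omega>) $ 1 = - S N \<omega>"
          using diff[OF N] by eventually_elim (simp add: axis_def)
        show "(\<lambda>\<omega>. (X T \<omega> - Y N T \<omega>) $ 1) \<in> borel_measurable M"
          by (intro borel_measurable_integrable integrable_bounded_linear[OF bounded_linear_vec_nth]
              Bochner_Integration.integrable_diff X_int Y_int N)
      qed (use S_meas in auto)
      finally have "\<bar>LINT \<omega>|M. S N \<omega>\<bar> = \<bar>(LINT \<omega>|M. X T \<omega> - Y N T \<omega>) $ 1\<bar>"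
        by simp
      then show ?thesis
        using component_le_norm_cart[of "LINT \<omega>|M. X T \<omega> - Y N T \<omega>" 1] e_eq[OF N] by linarith
    qed
    \<comment> \<open>The shift avoids \<open>N = 0\<close>, where nothing is known about
      \<open>Y\<close>. The dominating constant is \<open>T\<close> for the first component plus
      \<open>T\<close> for the defect.\<close>
    have "(\<lambda>N. s (Suc N)) \<longlonglongrightarrow> (LINT \<omega>|M. 0)"
      unfolding s_def
    proof (rule integral_dominated_convergence[where w = "\<lambda>_. 2 * T"])
      have lim: "(\<lambda>N. norm (- (S N \<omega> *\<^sub>R axis 1 1 + clock_defect T N N *\<^sub>R axis 3 1 :: real^4))) \<longlonglongrightarrow> 0"
        if "\<omega> \<in> space M" for \<omega>
        using S_lim[OF that] clock_defect_tendsto[OF T] by (auto intro!: tendsto_eq_intros)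
      have "AE \<omega> in M. \<forall>N. X T \<omega> - Y (Suc N) T \<omega>
          = - (S (Suc N) \<omega> *\<^sub>R axis 1 1 + clock_defect T (Suc N) (Suc N) *\<^sub>R axis 3 1)"
        unfolding AE_all_countable using diff by blast
      then show "AE \<omega> in M. (\<lambda>N. norm (X T \<omega> - Y (Suc N) T \<omega>)) \<longlonglongrightarrow> 0"
        using AE_space
      proof eventually_elim
        case (elim \<omega>)
        show ?case
          unfolding elim(1)[rule_format] by (rule LIMSEQ_Suc[OF lim[OF elim(2)]])
      qed
      fix N
      show "AE \<omega> in M. norm (norm (X T \<omega> - Y (Suc N) T \<omega>)) \<le> 2 * T"
        using diff[OF zero_less_Suc, of N]
      proof eventually_elim
        case (elim \<omega>)
        have "clock_defect T (Suc N) (Suc N) \<le> T / (2 * real (Suc N))"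
          using T by (intro clock_defect_le) auto
        also have "\<dots> \<le> T"
          using T by (simp add: divide_simps mult_left_mono)
        finally have "\<bar>clock_defect T (Suc N) (Suc N)\<bar> \<le> T"
          using clock_defect_nonneg[of "Suc N" T "Suc N"] T by simp
        moreover have "\<bar>S (Suc N) \<omega>\<bar> \<le> T"
          using euler_sum_bounds[of "Suc N" T] T by (simp add: S_def)
        ultimately show ?case
          using elim norm_triangle_ineq[of "S (Suc N) \<omega> *\<^sub>R axis 1 1 :: real^4"
              "clock_defect T (Suc N) (Suc N) *\<^sub>R axis 3 1"]
          by (simp add: norm_minus_cancel del: minus_add_distrib)
      qed
      show "(\<lambda>\<omega>. norm (X T \<omega> - Y (Suc N) T \<omega>)) \<in> borel_measurable M"
        by (intro borel_measurable_integrable Bochner_Integration.integrable_norm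
            Bochner_Integration.integrable_diff X_int Y_int) simp
    qed auto
    then have s_lim: "s \<longlonglongrightarrow> 0"
      by (simp add: filterlim_sequentially_Suc)
    have e_lim: "e \<longlonglongrightarrow> 0"
    proof (rule tendsto_sandwich[OF _ _ tendsto_const s_lim])
      show "\<forall>\<^sub>F N in sequentially. 0 \<le> e N"
        by (simp add: e_def)
      show "\<forall>\<^sub>F N in sequentially. e N \<le> s N"
        using eventually_gt_at_top[of 0] by eventually_elim (rule e_le_s)
    qed

    \<comment> \<open>Divergence of the rescaled errors\<close>
    have e_top: "filterlim (\<lambda>N. real N powr \<alpha> * e N) at_top sequentially" if \<alpha>: "0 < \<alpha>" for \<alpha>
    proof (rule filterlim_at_top_mono)
      \<comment> \<open>With this \<open>c\<close>, the choice
        \<open>a = ln (c * N) powr (1/3)\<close> turns the threshold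
        \<open>T * cos 1 / (4 * N) * exp (a^3) \<ge> 1\<close> into an equality.\<close>
      define c where "c = 4 / (T * cos 1)"
      have "0 < cos (1::real)"
        using pi_gt3 by (intro cos_gt_zero) auto
      then have c: "0 < c"
        using T by (simp add: c_def)
      show "filterlim (\<lambda>N. real N powr \<alpha> * (T / 4 *
          (exp (- (ln (c * real N) powr (1/3) + 1)\<^sup>2 / T) / (2 * sqrt (2 * pi * T))))) at_top sequentially"
        using \<alpha> c T by (rule slow_rate_at_top)
      have "\<forall>\<^sub>F N in sequentially. 1 \<le> c * real N"
        using c by real_asymp
      then show "\<forall>\<^sub>F N in sequentially. real N powr \<alpha> * (T / 4 *
          (exp (- (ln (c * real N) powr (1/3) + 1)\<^sup>2 / T) / (2 * sqrt (2 * pi * T))))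
          \<le> real N powr \<alpha> * e N"
        using eventually_ge_at_top[of 2]
      proof eventually_elim
        case (elim N)
        \<comment> \<open>The root is real and inverts cubing because \<open>1 \<le> c * N\<close>
          makes the logarithm nonnegative.\<close>
        have "(ln (c * real N) powr (1/3)) ^ 3 = ln (c * real N)"
          using elim powr_powr[of "ln (c * real N)" "1/3" 3] by simp
        then have "exp ((ln (c * real N) powr (1/3)) ^ 3) = c * real N"
          using elim c by simp
        moreover have "T * cos 1 / (4 * real N) * (c * real N) = 1"
          using elim T \<open>0 < cos 1\<close> by (simp add: c_def)
        ultimately have "1 \<le> T * cos 1 / (4 * real N) * exp ((ln (c * real N) powr (1/3)) ^ 3)"
          by simp
        then have "T / 4 * (exp (- (ln (c * real N) powr (1/3) + 1)\<^sup>2 / T) / (2 * sqrt (2 * pi * T)))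
            \<le> (LINT \<omega>|M. S N \<omega>)"
          unfolding S_def using elim T
          by (intro expectation_euler_sum_ge \<open>prob_space M\<close> D D_meas) auto
        also have "\<dots> \<le> e N"
          using elim by (intro ES_le_e) auto
        finally show ?case
          by (intro mult_left_mono) auto
      qed
    qed
    have s_top: "filterlim (\<lambda>N. real N powr \<alpha> * s N) at_top sequentially" if "0 < \<alpha>" for \<alpha>
    proof (rule filterlim_at_top_mono[OF e_top[OF that]])
      show "\<forall>\<^sub>F N in sequentially. real N powr \<alpha> * e N \<le> real N powr \<alpha> * s N"
        using eventually_gt_at_top[of 0] by eventually_elim (auto intro!: mult_left_mono e_le_s)
    qed
    have limits: "(\<lambda>N. ereal (real N powr \<alpha> * f N)) \<longlonglongrightarrow> (if \<alpha> = 0 then 0 else \<infinity>)"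
      if "0 \<le> \<alpha>" "f \<longlonglongrightarrow> 0" "\<And>\<alpha>. 0 < \<alpha> \<Longrightarrow> filterlim (\<lambda>N. real N powr \<alpha> * f N) at_top sequentially"
      for f :: "nat \<Rightarrow> real" and \<alpha>
    proof (cases "\<alpha> = 0")
      case True
      \<comment> \<open>Since \<open>0 powr 0\<close> is 0, the factor equals 1 only for positive
        \<open>N\<close>.\<close>
      have "\<forall>\<^sub>F N in sequentially. f N = real N powr \<alpha> * f N"
        using eventually_gt_at_top[of 0] by eventually_elim (simp add: True)
      then have "(\<lambda>N. real N powr \<alpha> * f N) \<longlonglongrightarrow> 0"
        by (rule Lim_transform_eventually[OF that(2)])
      then show ?thesis
        by (simp add: True zero_ereal_def del: ereal_eq_0)
    next
      case False
      then show ?thesis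
        using that(1) that(3)[of \<alpha>] by (simp add: tendsto_PInfty_eq_at_top)
    qed
    show "integrable M (X T)"
      by (rule X_int)
    show "integrable M (Y N T)" if "1 \<le> N" for N
      using that by (intro Y_int) auto
    show "(\<lambda>N. ereal (real N powr \<alpha> * (LINT \<omega>|M. norm (X T \<omega> - Y N T \<omega>))))
        \<longlonglongrightarrow> (if \<alpha> = 0 then 0 else \<infinity>)" if "0 \<le> \<alpha>" for \<alpha>
      using limits[OF that s_lim s_top] by (simp add: s_def)
    show "(\<lambda>N. ereal (real N powr \<alpha> * norm ((LINT \<omega>|M. X T \<omega>) - (LINT \<omega>|M. Y N T \<omega>))))
        \<longlonglongrightarrow> (if \<alpha> = 0 then 0 else \<infinity>)" if "0 \<le> \<alpha>" for \<alpha>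
      using limits[OF that e_lim e_top] by (simp add: e_def)
    show "\<not> (\<exists>c>0. \<forall>N\<ge>1. norm ((LINT \<omega>|M. X T \<omega>) - (LINT \<omega>|M. Y N T \<omega>))
        \<le> c * real N powr (- \<alpha>))" if "0 < \<alpha>" for \<alpha>
    proof
      assume "\<exists>c>0. \<forall>N\<ge>1. norm ((LINT \<omega>|M. X T \<omega>) - (LINT \<omega>|M. Y N T \<omega>)) \<le> c * real N powr (- \<alpha>)"
      then obtain c where c: "\<And>N. 1 \<le> N \<Longrightarrow> e N \<le> c * real N powr (- \<alpha>)"
        unfolding e_def by blast
      \<comment> \<open>A rate of order \<alpha> would bound the rescaled weak error by
        \<open>c\<close>, but it tends to infinity.\<close>
      have "\<forall>\<^sub>F N in sequentially. c < real N powr \<alpha> * e N"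
        using e_top[OF that] by (simp add: filterlim_at_top_dense)
      moreover have "\<forall>\<^sub>F N in sequentially. real N powr \<alpha> * e N \<le> c"
        using eventually_ge_at_top[of 1]
      proof eventually_elim
        case (elim N)
        have "real N powr \<alpha> * e N \<le> real N powr \<alpha> * (c * real N powr (- \<alpha>))"
          using c[OF elim] by (rule mult_left_mono) simp
        also have "\<dots> = c"
          using elim by (simp add: powr_minus)
        finally show ?case .
      qed
      ultimately have "\<forall>\<^sub>F N::nat in sequentially. False"
        by eventually_elim simp
      then show False
        by simp
    qed
  qed
qed

end
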